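(* Let $\psi(\varepsilon,d)=[g(d)+k]\,\psi_0^+(\varepsilon)+(1+k)\,\psi_0^-(\varepsilon)$, $\varepsilon\in\mathbb{S}^m$, $d\in[0,1]$, with the anisotropic volumetric splitting $$\psi_0^+(\varepsilon)=\Big(\frac{\mu}{m}+\frac{\lambda}{2}\Big)\langle\operatorname{tr}\varepsilon\rangle_+^2,\qquad \psi_0^-(\varepsilon)=\Big(\frac{\mu}{m}+\frac{\lambda}{2}\Big)\langle\operatorname{tr}\varepsilon\rangle_-^2+\mu\operatorname{dev}\varepsilon:\operatorname{dev}\varepsilon .$$ Then: (P1) $\psi(\varepsilon,\cdot)\in C^2$ for all $\varepsilon\in\mathbb{S}^m$, and $\psi(\cdot,d)\in C^{1,1}$ for all $d\in[0,1]$. (P2) The gradient $\nabla\psi(\cdot,d)$ is semismooth for all $d\in[0,1]$. (P3) There is $L\ge0$ independent of $d$ with $|\nabla\psi(A,d)-\nabla\psi(B,d)|\le L|A-B|_F$ for all $A,B\in\mathbb{S}^m$. (P4) There is $\eta>0$ independent of $d$ such that $\psi(tA+(1-t)B,d)\le t\psi(A,d)+(1-t)\psi(B,d)-\frac12\eta t(1-t)|A-B|_F^2$ for all $A,B\in\mathbb{S}^m$, $t\in[0,1]$. (P5) There is $C>0$ independent of $d$ such that $\psi(\varepsilon,d)\ge C|\varepsilon|_F^2$ for all $\varepsilon\in\mathbb{S}^m$. Furthermore, $\psi(\cdot,d)$ is not $C^2$, unless $g(d)=1$.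
   Context: $\mathbb{S}^m$ is the space of real symmetric $m\times m$ matrices with Frobenius norm $|\cdot|_F$; $\operatorname{dev}\varepsilon=\varepsilon-\frac{\operatorname{tr}\varepsilon}{m}I$, $A:B=\operatorname{tr}(A^TB)$, $\langle x\rangle_+=\max\{0,x\}$, $\langle x\rangle_-=\min\{0,x\}$. $\mu>0$ and $\lambda>-\tfrac23\mu$ are such that $\psi_0(\varepsilon)=\frac{\lambda}{2}(\operatorname{tr}\varepsilon)^2+\mu\operatorname{tr}(\varepsilon^2)$ is strongly convex on $\mathbb{S}^m$ (automatic for $m\le3$); in particular $\frac{\mu}{m}+\frac{\lambda}{2}>0$. $g:[0,1]\to[0,1]$ is convex, twice continuously differentiable, monotone decreasing with $g(0)=1$, $g(1)=0$; $k>0$ is a constant. $\nabla\psi(\cdot,d)$ is the gradient with respect to the matrix argument. $C^{1,1}$ means differentiable with locally Lipschitz continuous derivative. A locally Lipschitz map $F:\mathbb{S}^m\to\mathbb{S}^m$ is semismooth if for every $A,V\in\mathbb{S}^m$ the limit $\lim_{n\to\infty}G_nV_n$ exists and is the same for all sequences $V_n\to V$, $t_n\searrow0$, $G_n\in\partial F(A+t_nV_n)$, where $\partial F$ is Clarke's generalized Jacobian. *)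

theory Defs
  imports "HOL-Analysis.Analysis"
begin

section \<open>The Euclidean space of real symmetric matrices\<close>

text \<open>
  The dimension \<open>m\<close> is \<open>CARD('m)\<close>.  Making the symmetric matrices a Euclidean space of their own
  means that derivatives, gradients and generalized Jacobians below are taken in the space of
  symmetric matrices and not in the space of all square matrices.  The inner product and the norm
  are those of \<open>real^'m^'m\<close>, i.e. the Frobenius ones; see \<open>inner_sym_eq_ddot\<close> and
  \<open>norm_sym_eq_frobenius\<close>.
\<close>

typedef ('m::finite) sym = "{A :: real^'m^'m. transpose A = A}"
  morphisms mat_of_sym sym_of_mat
  by (rule exI[of _ 0]) (simp add: transpose_def vec_eq_iff)

setup_lifting type_definition_sym

lemma transpose_mat_of_sym [simp]: "transpose (mat_of_sym A) = mat_of_sym A"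
  using mat_of_sym[of A] by simp

instantiation sym :: (finite) real_vector
begin

lift_definition zero_sym :: "'a sym" is 0
  by (simp add: transpose_def vec_eq_iff)
lift_definition plus_sym :: "'a sym \<Rightarrow> 'a sym \<Rightarrow> 'a sym" is "(+)"
  by (simp add: transpose_def vec_eq_iff)
lift_definition minus_sym :: "'a sym \<Rightarrow> 'a sym \<Rightarrow> 'a sym" is "(-)"
  by (simp add: transpose_def vec_eq_iff)
lift_definition uminus_sym :: "'a sym \<Rightarrow> 'a sym" is uminus
  by (simp add: transpose_def vec_eq_iff)
lift_definition scaleR_sym :: "real \<Rightarrow> 'a sym \<Rightarrow> 'a sym" is "(*\<^sub>R)"
  by (simp add: transpose_def vec_eq_iff)

instance
  by standard (transfer; simp add: algebra_simps)+

end

instantiation sym :: (finite) real_inner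
begin

lift_definition inner_sym :: "'a sym \<Rightarrow> 'a sym \<Rightarrow> real" is inner .
lift_definition norm_sym :: "'a sym \<Rightarrow> real" is norm .

definition dist_sym :: "'a sym \<Rightarrow> 'a sym \<Rightarrow> real"
  where "dist_sym A B = norm (A - B)"

definition sgn_sym :: "'a sym \<Rightarrow> 'a sym"
  where "sgn_sym A = A /\<^sub>R norm A"

definition uniformity_sym :: "('a sym \<times> 'a sym) filter"
  where "uniformity_sym = (INF e\<in>{0 <..}. principal {(x, y). dist x y < e})"

definition open_sym :: "'a sym set \<Rightarrow> bool"
  where "open_sym U \<longleftrightarrow> (\<forall>x\<in>U. eventually (\<lambda>(x', y). x' = x \<longrightarrow> y \<in> U) uniformity)"

instance
proof
  fix A B C :: "'a sym" and r :: real and U :: "'a sym set"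
  show "dist A B = norm (A - B)" by (rule dist_sym_def)
  show "sgn A = A /\<^sub>R norm A" by (rule sgn_sym_def)
  show "(uniformity :: ('a sym \<times> 'a sym) filter)
      = (INF e\<in>{0 <..}. principal {(x, y). dist x y < e})" by (rule uniformity_sym_def)
  show "open U \<longleftrightarrow> (\<forall>x\<in>U. eventually (\<lambda>(x', y). x' = x \<longrightarrow> y \<in> U) uniformity)"
    by (rule open_sym_def)
  show "inner A B = inner B A" by transfer (rule inner_commute)
  show "inner (A + B) C = inner A C + inner B C" by transfer (rule inner_add_left)
  show "inner (r *\<^sub>R A) B = r * inner A B" by transfer simp
  show "0 \<le> inner A A" by transfer simp
  show "inner A A = 0 \<longleftrightarrow> A = 0" by transfer simp
  show "norm A = sqrt (inner A A)" by transfer (rule norm_eq_sqrt_inner)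
qed

end

lift_definition sym_one :: "'m::finite sym" is "mat 1"
  by simp

lemma mat_of_sym_simps [simp]:
  "mat_of_sym 0 = 0"
  "mat_of_sym (A + B) = mat_of_sym A + mat_of_sym B"
  "mat_of_sym (A - B) = mat_of_sym A - mat_of_sym B"
  "mat_of_sym (- A) = - mat_of_sym A"
  "mat_of_sym (r *\<^sub>R A) = r *\<^sub>R mat_of_sym A"
  "mat_of_sym sym_one = mat 1"
  by (transfer; simp)+

lemma sym_orthonormal_basis:
  "\<exists>S :: 'm::finite sym set. S \<noteq> {} \<and> finite S \<and>
     (\<forall>u\<in>S. \<forall>v\<in>S. inner u v = (if u = v then 1 else 0)) \<and>
     (\<forall>x. (\<forall>u\<in>S. inner x u = 0) \<longleftrightarrow> x = 0)"
proof -
  let ?T = "{A :: real^'m^'m. transpose A = A}"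
  have sub: "subspace ?T"
    by (auto simp: subspace_def transpose_def vec_eq_iff)
  obtain B where B: "B \<subseteq> ?T" "pairwise orthogonal B" "\<forall>x\<in>B. norm x = 1"
      "independent B" "span B = ?T"
  proof (rule orthonormal_basis_subspace[OF sub])
    fix B assume *: "B \<subseteq> ?T" "pairwise orthogonal B" "independent B" "span B = ?T"
      and "\<And>x. x \<in> B \<Longrightarrow> norm x = 1"
    then have "\<forall>x\<in>B. norm x = 1" by simp
    with * show thesis by (intro that)
  qed
  have rep: "mat_of_sym (sym_of_mat b) = b" if "b \<in> B" for b
    by (rule sym_of_mat_inverse) (use that B(1) in blast)
  then have inj: "inj_on sym_of_mat B"
    by (rule inj_on_inverseI)
  let ?S = "sym_of_mat ` B"
  have fin: "finite ?S"
    using independent_imp_finite[OF B(4)] by simp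
  have orth: "\<forall>u\<in>?S. \<forall>v\<in>?S. inner u v = (if u = v then 1 else 0)"
  proof (intro ballI)
    fix u v assume "u \<in> ?S" "v \<in> ?S"
    then obtain a b where ab: "a \<in> B" "b \<in> B" "u = sym_of_mat a" "v = sym_of_mat b"
      by blast
    have "inner u v = inner a b"
      using ab by (simp add: inner_sym.rep_eq rep)
    moreover have "inner a b = (if a = b then 1 else 0)"
    proof (cases "a = b")
      case True
      then show ?thesis using B(3) ab(1) by (simp add: norm_eq_sqrt_inner)
    next
      case False
      then show ?thesis using B(2) ab by (auto simp: pairwise_def orthogonal_def)
    qed
    moreover have "a = b \<longleftrightarrow> u = v"
      using inj ab by (auto simp: inj_on_def)
    ultimately show "inner u v = (if u = v then 1 else 0)" by simp
  qed
  have zero: "x = 0" if "\<forall>u\<in>?S. inner x u = 0" for x :: "'m sym"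
  proof -
    have "orthogonal (mat_of_sym x) b" if "b \<in> B" for b
      using \<open>\<forall>u\<in>?S. inner x u = 0\<close> that
      by (auto simp: orthogonal_def inner_sym.rep_eq rep)
    moreover have "mat_of_sym x \<in> span B"
      using B(5) by simp
    ultimately have "orthogonal (mat_of_sym x) (mat_of_sym x)"
      using orthogonal_to_span by blast
    then show "x = 0"
      by (simp add: orthogonal_def flip: mat_of_sym_inject)
  qed
  have "(sym_one :: 'm sym) \<noteq> 0"
    by (simp add: mat_def vec_eq_iff flip: mat_of_sym_inject)
  with zero have "?S \<noteq> {}" by blast
  with fin orth zero show ?thesis
    by (intro exI[of _ ?S]) auto
qed

instantiation sym :: (finite) euclidean_space
begin

definition Basis_sym :: "'a sym set" where
  "Basis_sym = (SOME S. S \<noteq> {} \<and> finite S \<and>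
     (\<forall>u\<in>S. \<forall>v\<in>S. inner u v = (if u = v then 1 else 0)) \<and>
     (\<forall>x. (\<forall>u\<in>S. inner x u = 0) \<longleftrightarrow> x = 0))"

instance
proof -
  have "(Basis :: 'a sym set) \<noteq> {} \<and> finite (Basis :: 'a sym set) \<and>
     (\<forall>u\<in>Basis. \<forall>v\<in>(Basis :: 'a sym set). inner u v = (if u = v then 1 else 0)) \<and>
     (\<forall>x :: 'a sym. (\<forall>u\<in>Basis. inner x u = 0) \<longleftrightarrow> x = 0)"
    unfolding Basis_sym_def by (rule someI_ex[OF sym_orthonormal_basis])
  then show "OFCLASS('a sym, euclidean_space_class)"
    by intro_classes auto
qed

end

definition ddot :: "'m::finite sym \<Rightarrow> 'm sym \<Rightarrow> real"
  where "ddot A B = trace (transpose (mat_of_sym A) ** mat_of_sym B)"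

lemma inner_sym_eq_ddot: "inner A B = ddot A B"
proof -
  have "inner A B = (\<Sum>i\<in>UNIV. \<Sum>j\<in>UNIV. mat_of_sym A $ i $ j * mat_of_sym B $ i $ j)"
    by (simp add: inner_sym.rep_eq inner_vec_def)
  also have "\<dots> = (\<Sum>j\<in>UNIV. \<Sum>i\<in>UNIV. mat_of_sym A $ i $ j * mat_of_sym B $ i $ j)"
    by (rule sum.swap)
  finally show ?thesis
    by (simp add: ddot_def trace_def matrix_matrix_mult_def transpose_def)
qed

lemma norm_sym_eq_frobenius:
  "norm A = sqrt (\<Sum>i\<in>UNIV. \<Sum>j\<in>UNIV. (mat_of_sym A $ i $ j)\<^sup>2)"
  by (simp add: norm_eq_sqrt_inner inner_sym.rep_eq inner_vec_def power2_eq_square)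

definition tr :: "'m::finite sym \<Rightarrow> real"
  where "tr A = trace (mat_of_sym A)"

definition dev :: "'m::finite sym \<Rightarrow> 'm sym"
  where "dev A = A - (tr A / real CARD('m)) *\<^sub>R sym_one"

section \<open>Regularity notions\<close>

definition strongly_convex :: "('a::real_normed_vector \<Rightarrow> real) \<Rightarrow> bool" where
  "strongly_convex f \<longleftrightarrow> (\<exists>\<eta>>0. \<forall>A B. \<forall>t\<in>{0..1}.
     f (t *\<^sub>R A + (1 - t) *\<^sub>R B)
       \<le> t * f A + (1 - t) * f B - 1 / 2 * \<eta> * t * (1 - t) * (norm (A - B))\<^sup>2)"

text \<open>
  Derivatives are taken within \<open>S\<close>, so that on \<open>S = {0..1}\<close> they are one-sided at the end points.
\<close>

definition C2_on ::
  "'a::real_normed_vector set \<Rightarrow> ('a \<Rightarrow> 'b::real_normed_vector) \<Rightarrow> bool" where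
  "C2_on S f \<longleftrightarrow>
     (\<exists>(f' :: 'a \<Rightarrow> 'a \<Rightarrow>\<^sub>L 'b) (f'' :: 'a \<Rightarrow> 'a \<Rightarrow>\<^sub>L 'a \<Rightarrow>\<^sub>L 'b).
        (\<forall>x\<in>S. (f has_derivative blinfun_apply (f' x)) (at x within S)) \<and>
        (\<forall>x\<in>S. (f' has_derivative blinfun_apply (f'' x)) (at x within S)) \<and>
        continuous_on S f'')"

definition locally_lipschitz :: "('a::metric_space \<Rightarrow> 'b::metric_space) \<Rightarrow> bool" where
  "locally_lipschitz F \<longleftrightarrow> (\<forall>x. \<exists>u>0. \<exists>L. L-lipschitz_on (cball x u) F)"

definition C11 :: "('a::real_normed_vector \<Rightarrow> 'b::real_normed_vector) \<Rightarrow> bool" where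
  "C11 f \<longleftrightarrow>
     (\<exists>f' :: 'a \<Rightarrow> 'a \<Rightarrow>\<^sub>L 'b.
        (\<forall>x. (f has_derivative blinfun_apply (f' x)) (at x)) \<and> locally_lipschitz f')"

definition gradient :: "('a::real_inner \<Rightarrow> real) \<Rightarrow> 'a \<Rightarrow> 'a" where
  "gradient f x = (THE D. GDERIV f x :> D)"

lemma gradient_eqI:
  assumes "GDERIV f x :> D"
  shows "gradient f x = D"
  unfolding gradient_def
proof (rule the_equality)
  show "GDERIV f x :> D" by (rule assms)
next
  fix E assume "GDERIV f x :> E"
  with assms have "(\<lambda>h. inner h E) = (\<lambda>h. inner h D)"
    unfolding gderiv_def by (rule has_derivative_unique[rotated])
  then show "E = D"
    by (metis inner_eq_zero_iff inner_diff_right right_minus_eq)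
qed

definition clarke_jacobian ::
  "('a::euclidean_space \<Rightarrow> 'b::euclidean_space) \<Rightarrow> 'a \<Rightarrow> ('a \<Rightarrow>\<^sub>L 'b) set" where
  "clarke_jacobian F x = convex hull
     {J. \<exists>(X :: nat \<Rightarrow> 'a) (D :: nat \<Rightarrow> 'a \<Rightarrow>\<^sub>L 'b).
        X \<longlonglongrightarrow> x \<and> D \<longlonglongrightarrow> J \<and>
        (\<forall>n. (F has_derivative blinfun_apply (D n)) (at (X n)))}"

text \<open>
  The existentially quantified \<open>l\<close> comes before the sequences: it is their common limit.  The
  sequences \<open>t\<close> are positive null sequences; demanding in addition that they decrease would give
  the same notion, as one sees by passing to subsequences.
\<close>

definition semismooth :: "('a::euclidean_space \<Rightarrow> 'b::euclidean_space) \<Rightarrow> bool" where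
  "semismooth F \<longleftrightarrow> locally_lipschitz F \<and>
     (\<forall>A V. \<exists>l. \<forall>(W :: nat \<Rightarrow> 'a) (t :: nat \<Rightarrow> real) (G :: nat \<Rightarrow> 'a \<Rightarrow>\<^sub>L 'b).
        W \<longlonglongrightarrow> V \<and> (\<forall>n. 0 < t n) \<and> t \<longlonglongrightarrow> 0 \<and>
        (\<forall>n. G n \<in> clarke_jacobian F (A + t n *\<^sub>R W n))
        \<longrightarrow> (\<lambda>n. blinfun_apply (G n) (W n)) \<longlonglongrightarrow> l)"

section \<open>The energy densities\<close>

text \<open>The parameters \<open>mu\<close> and \<open>lam\<close> are the Lame constants.\<close>

definition psi0 :: "real \<Rightarrow> real \<Rightarrow> 'm::finite sym \<Rightarrow> real" where
  "psi0 mu lam \<epsilon> = lam / 2 * (tr \<epsilon>)\<^sup>2 + mu * trace (mat_of_sym \<epsilon> ** mat_of_sym \<epsilon>)"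

definition psi0_plus :: "real \<Rightarrow> real \<Rightarrow> 'm::finite sym \<Rightarrow> real" where
  "psi0_plus mu lam \<epsilon> = (mu / real CARD('m) + lam / 2) * (max 0 (tr \<epsilon>))\<^sup>2"

definition psi0_minus :: "real \<Rightarrow> real \<Rightarrow> 'm::finite sym \<Rightarrow> real" where
  "psi0_minus mu lam \<epsilon> =
     (mu / real CARD('m) + lam / 2) * (min 0 (tr \<epsilon>))\<^sup>2 + mu * ddot (dev \<epsilon>) (dev \<epsilon>)"

definition psi ::
  "real \<Rightarrow> real \<Rightarrow> (real \<Rightarrow> real) \<Rightarrow> real \<Rightarrow> 'm::finite sym \<Rightarrow> real \<Rightarrow> real" where
  "psi mu lam g k \<epsilon> d = (g d + k) * psi0_plus mu lam \<epsilon> + (1 + k) * psi0_minus mu lam \<epsilon>"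

end

theory Submission
  imports Defs
begin

text \<open>
  The one source of nonsmoothness is the sign of the trace.  Since \<open>\<langle>s\<rangle>\<^sub>+\<^sup>2 = s\<^sup>2 - \<langle>s\<rangle>\<^sub>-\<^sup>2\<close>, the energy
  is, with the bulk modulus \<open>\<kappa> = \<mu>/m + \<lambda>/2\<close>,
  \<open>\<psi>(A, d) = a (tr A)\<^sup>2 + c |dev A|\<^sup>2 + r \<langle>tr A\<rangle>\<^sub>-\<^sup>2\<close> with \<open>a = \<kappa> (g(d) + k)\<close>, \<open>c = (1 + k) \<mu>\<close> and
  \<open>r = \<kappa> (1 - g(d)) \<ge> 0\<close>:
  a quadratic form plus a convex penalty on compression.

  The split of \<open>A\<close> into its spherical and deviatoric parts is orthogonal, so the quadratic form is
  bounded below by \<open>min (a m) c\<close> times the squared norm.  Since \<open>a \<ge> \<kappa> k\<close>, this gives coercivity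
  (P5) and strong convexity (P4) with constants free of \<open>d\<close>; the penalty is nonnegative and convex
  and can only help.  That \<open>\<kappa> > 0\<close> comes from the strong convexity of \<open>\<psi>\<^sub>0\<close>
  (\<open>bulk_modulus_pos\<close>).

  The gradient is a linear map plus \<open>min 0 (tr A)\<close> times a fixed matrix.  It is thus linear on each
  of the half-spaces \<open>tr A \<ge> 0\<close> and \<open>tr A \<le> 0\<close>, with the two linear branches meeting continuously
  along the hyperplane \<open>tr A = 0\<close>.  Such a bent linear map is globally Lipschitz (P3 and the second
  half of P1).  It is semismooth (\<open>semismooth_bent\<close>): its generalized Jacobians are convex
  combinations of the branches, and applying such a Jacobian taken at \<open>A + t W\<close> to \<open>W\<close> either gives
  one fixed branch at \<open>W\<close>, if \<open>A\<close> is off the hyperplane and \<open>t\<close> is small, or the value of the map itself at \<open>W\<close>, if \<open>A\<close> is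
  on it.  Finally, it is differentiable at \<open>0\<close> only if its branches coincide, that is if \<open>r = 0\<close>, so
  the energy is \<open>C\<^sup>2\<close> in \<open>A\<close> exactly when \<open>g(d) = 1\<close>.
\<close>

section \<open>Linear maps bent along a hyperplane\<close>

definition bent ::
  "('a::real_inner \<Rightarrow>\<^sub>L 'b::real_normed_vector) \<Rightarrow> 'a \<Rightarrow> 'b \<Rightarrow> 'a \<Rightarrow> 'b" where
  "bent G e v x = G x + min 0 (inner e x) *\<^sub>R v"

definition lower_branch ::
  "('a::real_inner \<Rightarrow>\<^sub>L 'b::real_normed_vector) \<Rightarrow> 'a \<Rightarrow> 'b \<Rightarrow> 'a \<Rightarrow>\<^sub>L 'b" where
  "lower_branch G e v = G + (blinfun_scaleR_left v o\<^sub>L blinfun_inner_right e)"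

lemma lower_branch_apply [simp]: "lower_branch G e v x = G x + inner e x *\<^sub>R v"
  by (simp add: lower_branch_def blinfun.add_left)

lemma bent_upper: "inner e x \<ge> 0 \<Longrightarrow> bent G e v x = G x"
  by (simp add: bent_def)

lemma bent_lower: "inner e x \<le> 0 \<Longrightarrow> bent G e v x = lower_branch G e v x"
  by (simp add: bent_def)

lemma bent_lipschitz:
  "norm (bent G e v x - bent G e v y) \<le> (norm G + norm e * norm v) * norm (x - y)"
proof -
  have "bent G e v x - bent G e v y =
      G (x - y) + (min 0 (inner e x) - min 0 (inner e y)) *\<^sub>R v"
    by (simp add: bent_def blinfun.diff_right algebra_simps)
  also have "norm \<dots> \<le> norm (G (x - y)) + \<bar>min 0 (inner e x) - min 0 (inner e y)\<bar> * norm v"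
    by (rule norm_triangle_le) simp
  also have "\<bar>min 0 (inner e x) - min 0 (inner e y)\<bar> \<le> \<bar>inner e (x - y)\<bar>"
    by (simp add: inner_diff_right)
  also have "\<bar>inner e (x - y)\<bar> \<le> norm e * norm (x - y)"
    by (rule Cauchy_Schwarz_ineq2)
  also have "norm (G (x - y)) \<le> norm G * norm (x - y)"
    by (rule norm_blinfun)
  finally show ?thesis
    by (simp add: algebra_simps mult_right_mono)
qed

lemma lipschitz_imp_locally_lipschitz:
  assumes "\<And>x y. norm (F x - F y) \<le> L * norm (x - y)" and "L \<ge> 0"
  shows "locally_lipschitz F"
  unfolding locally_lipschitz_def
proof
  fix x
  have "L-lipschitz_on (cball x 1) F"
    using assms by (intro lipschitz_onI) (auto simp: dist_norm)
  then show "\<exists>u>0. \<exists>L. L-lipschitz_on (cball x u) F"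
    by (intro exI[of _ 1] conjI exI) auto
qed

lemma bent_locally_lipschitz: "locally_lipschitz (bent G e v)"
  using bent_lipschitz by (rule lipschitz_imp_locally_lipschitz) auto

lemma bent_derivative_upper:
  assumes "inner e x > 0" and "(bent G e v has_derivative blinfun_apply D) (at x)"
  shows "D = G"
proof -
  have "open {y. inner e y > 0}"
    by (intro open_Collect_less continuous_intros)
  moreover have "(blinfun_apply G has_derivative blinfun_apply G) (at x)"
    by (rule bounded_linear_imp_has_derivative) (rule blinfun.bounded_linear_right)
  moreover have "G y = bent G e v y" if "y \<in> {y. inner e y > 0}" for y
    using that by (simp add: bent_upper)
  ultimately have "(bent G e v has_derivative blinfun_apply G) (at x)"
    using assms(1) by (blast intro: has_derivative_transform_within_open)
  with assms(2) have "blinfun_apply D = blinfun_apply G"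
    by (rule has_derivative_unique)
  then show ?thesis
    by (simp only: blinfun_apply_inject)
qed

lemma bent_derivative_lower:
  assumes "inner e x < 0" and "(bent G e v has_derivative blinfun_apply D) (at x)"
  shows "D = lower_branch G e v"
proof -
  let ?H = "lower_branch G e v"
  have "open {y. inner e y < 0}"
    by (intro open_Collect_less continuous_intros)
  moreover have "(blinfun_apply ?H has_derivative blinfun_apply ?H) (at x)"
    by (rule bounded_linear_imp_has_derivative) (rule blinfun.bounded_linear_right)
  moreover have "?H y = bent G e v y" if "y \<in> {y. inner e y < 0}" for y
    using that by (simp add: bent_lower)
  ultimately have "(bent G e v has_derivative blinfun_apply ?H) (at x)"
    using assms(1) by (blast intro: has_derivative_transform_within_open)
  with assms(2) have "blinfun_apply D = blinfun_apply ?H"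
    by (rule has_derivative_unique)
  then show ?thesis
    by (simp only: blinfun_apply_inject)
qed

text \<open>
  Along a line crossing the hyperplane at \<open>x\<close> the two one-sided derivatives come from different
  branches; differentiability makes them equal.  The second conclusion says that the branches then
  coincide, unless \<open>e = 0\<close>.
\<close>

lemma bent_derivative_on_hyperplane:
  assumes x: "inner e x = 0" and D: "(bent G e v has_derivative blinfun_apply D) (at x)"
  shows "D w = G w" and "inner e w *\<^sub>R v = 0"
proof -
  have "((bent G e v \<circ> (\<lambda>t. x + t *\<^sub>R w)) has_derivative
      (blinfun_apply D \<circ> (\<lambda>t. t *\<^sub>R w))) (at 0)"
    by (rule diff_chain_at) (auto intro!: derivative_eq_intros D)
  then have "((\<lambda>t. bent G e v (x + t *\<^sub>R w)) has_vector_derivative D w) (at 0)"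
    by (simp add: has_vector_derivative_def o_def blinfun.scaleR_right)
  then have path: "((\<lambda>t. bent G e v (x + t *\<^sub>R w)) has_vector_derivative D w) (at 0 within S)" for S
    by (rule has_vector_derivative_at_within)
  have line: "((\<lambda>t. G x + t *\<^sub>R u) has_vector_derivative u) (at 0 within S)" for u S
    unfolding has_vector_derivative_def by (auto intro!: derivative_eq_intros)
  \<comment> \<open>\<open>min 0 (t s)\<close> is \<open>t min 0 s\<close> for \<open>t \<ge> 0\<close> but \<open>t max 0 s\<close> for \<open>t \<le> 0\<close>; this spares a case split on
    the sign of \<open>inner e w\<close>.\<close>
  have right: "D w = G w + min 0 (inner e w) *\<^sub>R v"
  proof (rule vector_derivative_unique_within)
    show "at (0::real) within {0..} \<noteq> bot"
      by (simp add: at_within_Ici_at_right)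
    show "((\<lambda>t. bent G e v (x + t *\<^sub>R w)) has_vector_derivative
        G w + min 0 (inner e w) *\<^sub>R v) (at 0 within {0..})"
    proof (rule has_vector_derivative_transform[OF _ _ line])
      fix t :: real assume "t \<in> {0..}"
      then have "min 0 (t * inner e w) = t * min 0 (inner e w)"
        by (auto simp: min_def mult_le_0_iff zero_le_mult_iff)
      then show "bent G e v (x + t *\<^sub>R w) = G x + t *\<^sub>R (G w + min 0 (inner e w) *\<^sub>R v)"
        using x by (simp add: bent_def inner_add_right blinfun.add_right blinfun.scaleR_right
          scaleR_add_right)
    qed simp
  qed (rule path)
  have left: "D w = G w + max 0 (inner e w) *\<^sub>R v"
  proof (rule vector_derivative_unique_within)
    show "at (0::real) within {..0} \<noteq> bot"
      by (simp add: at_within_Iic_at_left)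
    show "((\<lambda>t. bent G e v (x + t *\<^sub>R w)) has_vector_derivative
        G w + max 0 (inner e w) *\<^sub>R v) (at 0 within {..0})"
    proof (rule has_vector_derivative_transform[OF _ _ line])
      fix t :: real assume "t \<in> {..0}"
      then have "min 0 (t * inner e w) = t * max 0 (inner e w)"
        by (auto simp: min_def max_def mult_le_0_iff zero_le_mult_iff)
      then show "bent G e v (x + t *\<^sub>R w) = G x + t *\<^sub>R (G w + max 0 (inner e w) *\<^sub>R v)"
        using x by (simp add: bent_def inner_add_right blinfun.add_right blinfun.scaleR_right
          scaleR_add_right)
    qed simp
  qed (rule path)
  from left right have *: "min 0 (inner e w) *\<^sub>R v = max 0 (inner e w) *\<^sub>R v"
    by simp
  then show "inner e w *\<^sub>R v = 0"
    by (auto simp: min_def max_def split: if_splits)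
  then show "D w = G w"
    using right by (auto simp: min_def split: if_splits)
qed

text \<open>
  The candidates for limits of derivatives near a point \<open>x\<close> with \<open>s = inner e x\<close>.
\<close>

definition bent_branches ::
  "('a::real_inner \<Rightarrow>\<^sub>L 'b::real_normed_vector) \<Rightarrow> 'a \<Rightarrow> 'b \<Rightarrow> real \<Rightarrow> ('a \<Rightarrow>\<^sub>L 'b) set" where
  "bent_branches G e v s =
     (if s > 0 then {G} else if s < 0 then {lower_branch G e v} else {G, lower_branch G e v})"

lemma bent_derivative_in_branches:
  assumes "(bent G e v has_derivative blinfun_apply D) (at x)"
  shows "D \<in> bent_branches G e v (inner e x)"
proof -
  consider "inner e x > 0" | "inner e x < 0" | "inner e x = 0" by linarith
  then show ?thesis
  proof cases
    case 3
    then have "D = G"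
      using bent_derivative_on_hyperplane(1)[OF _ assms] by (intro blinfun_eqI) auto
    with 3 show ?thesis by (simp add: bent_branches_def)
  qed (use assms in \<open>auto simp: bent_branches_def
    dest: bent_derivative_upper bent_derivative_lower\<close>)
qed

text \<open>
  Every derivative is one of the branches, and by continuity of \<open>inner e\<close> the branches available at
  points near \<open>x\<close> are among those available at \<open>x\<close>.  A finite set is closed, so limits of derivatives
  do not leave it.
\<close>

lemma clarke_jacobian_bent:
  fixes G :: "'a::euclidean_space \<Rightarrow>\<^sub>L 'b::euclidean_space"
  shows "clarke_jacobian (bent G e v) x \<subseteq> convex hull (bent_branches G e v (inner e x))"
  unfolding clarke_jacobian_def
proof (rule hull_mono, safe)
  fix J X and D :: "nat \<Rightarrow> 'a \<Rightarrow>\<^sub>L 'b"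
  assume X: "X \<longlonglongrightarrow> x" and J: "D \<longlonglongrightarrow> J"
    and "\<forall>n. (bent G e v has_derivative blinfun_apply (D n)) (at (X n))"
  then have D: "D n \<in> bent_branches G e v (inner e (X n))" for n
    by (blast intro: bent_derivative_in_branches)
  have lim: "(\<lambda>n. inner e (X n)) \<longlonglongrightarrow> inner e x"
    by (intro tendsto_intros X)
  have "\<forall>\<^sub>F n in sequentially.
      bent_branches G e v (inner e (X n)) \<subseteq> bent_branches G e v (inner e x)"
  proof (cases "inner e x" "0::real" rule: linorder_cases)
    case less
    from order_tendstoD(2)[OF lim less] show ?thesis
      by eventually_elim (use less in \<open>auto simp: bent_branches_def\<close>)
  next
    case greater
    from order_tendstoD(1)[OF lim greater] show ?thesis
      by eventually_elim (use greater in \<open>auto simp: bent_branches_def\<close>)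
  qed (auto simp: bent_branches_def)
  then have "\<forall>\<^sub>F n in sequentially. D n \<in> bent_branches G e v (inner e x)"
    by eventually_elim (use D in auto)
  moreover have "closed (bent_branches G e v (inner e x))"
    by (auto simp: bent_branches_def intro!: finite_imp_closed)
  ultimately show "J \<in> bent_branches G e v (inner e x)"
    using J by (intro Lim_in_closed_set) auto
qed

text \<open>
  The last conclusion matters on the hyperplane: whatever the weight \<open>u\<close>, there a generalized
  Jacobian agrees with the map itself in the directions \<open>w\<close> tangent to the hyperplane.
\<close>

lemma clarke_jacobian_bent_cases:
  fixes G :: "'a::euclidean_space \<Rightarrow>\<^sub>L 'b::euclidean_space"
  assumes "J \<in> clarke_jacobian (bent G e v) x"
  shows "inner e x > 0 \<Longrightarrow> J = G"
    and "inner e x < 0 \<Longrightarrow> J = lower_branch G e v"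
    and "\<exists>u. \<forall>w. J w = G w + (u * inner e w) *\<^sub>R v"
proof -
  have J: "J \<in> convex hull (bent_branches G e v (inner e x))"
    using clarke_jacobian_bent assms by blast
  show up: "J = G" if "inner e x > 0"
    using J that by (simp add: bent_branches_def)
  show low: "J = lower_branch G e v" if "inner e x < 0"
    using J that by (simp add: bent_branches_def)
  show "\<exists>u. \<forall>w. J w = G w + (u * inner e w) *\<^sub>R v"
  proof (cases "inner e x" "0::real" rule: linorder_cases)
    case less
    then show ?thesis using low by (intro exI[of _ 1]) simp
  next
    case greater
    then show ?thesis using up by (intro exI[of _ 0]) simp
  next
    case equal
    then obtain p q where "p + q = 1" "J = p *\<^sub>R G + q *\<^sub>R lower_branch G e v"
      using J by (auto simp: bent_branches_def convex_hull_2)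
    then have "J w = G w + (q * inner e w) *\<^sub>R v" for w
      by (simp add: blinfun.add_left blinfun.scaleR_left scaleR_add_right add.assoc[symmetric]
          scaleR_add_left[symmetric])
    then show ?thesis by blast
  qed
qed

text \<open>
  If \<open>A\<close> is off the hyperplane, a single branch is eventually active.  If \<open>inner e A = 0\<close>, the active branch at
  \<open>A + t W\<close> is selected by the sign of \<open>t * inner e W\<close>, hence by that of \<open>inner e W\<close>, which also
  selects the branch in the value of the map at \<open>W\<close>.  So the Jacobians applied to \<open>W\<close> give
  the values of the continuous map at \<open>W\<close>, which tend to its value at \<open>V\<close>.
\<close>

lemma semismooth_bent:
  fixes G :: "'a::euclidean_space \<Rightarrow>\<^sub>L 'b::euclidean_space"
  shows "semismooth (bent G e v)"
  unfolding semismooth_def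
proof (intro conjI allI bent_locally_lipschitz)
  fix A V :: 'a
  let ?H = "lower_branch G e v"
  define l where "l = (if inner e A > 0 then G V else if inner e A < 0 then ?H V
    else bent G e v V)"
  have "(\<lambda>n. J n (W n)) \<longlonglongrightarrow> l"
    if W: "W \<longlonglongrightarrow> V" and t: "\<forall>n. 0 < t n" "t \<longlonglongrightarrow> 0"
      and J: "\<forall>n. J n \<in> clarke_jacobian (bent G e v) (A + t n *\<^sub>R W n)"
    for W t and J :: "nat \<Rightarrow> 'a \<Rightarrow>\<^sub>L 'b"
  proof -
    have lim: "(\<lambda>n. inner e (A + t n *\<^sub>R W n)) \<longlonglongrightarrow> inner e (A + 0 *\<^sub>R V)"
      by (intro tendsto_intros W t)
    note cases = clarke_jacobian_bent_cases[OF J[rule_format]]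
    show ?thesis
    proof (cases "inner e A" "0::real" rule: linorder_cases)
      case less
      then have "\<forall>\<^sub>F n in sequentially. inner e (A + t n *\<^sub>R W n) < 0"
        using order_tendstoD(2)[OF lim] by simp
      then have "\<forall>\<^sub>F n in sequentially. ?H (W n) = J n (W n)"
        by eventually_elim (simp only: cases(2))
      moreover have "(\<lambda>n. ?H (W n)) \<longlonglongrightarrow> ?H V"
        by (intro tendsto_intros W)
      ultimately show ?thesis
        using less by (simp add: l_def tendsto_cong del: lower_branch_apply)
    next
      case greater
      then have "\<forall>\<^sub>F n in sequentially. inner e (A + t n *\<^sub>R W n) > 0"
        using order_tendstoD(1)[OF lim] by simp
      then have "\<forall>\<^sub>F n in sequentially. G (W n) = J n (W n)"
        by eventually_elim (simp only: cases(1))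
      moreover have "(\<lambda>n. G (W n)) \<longlonglongrightarrow> G V"
        by (intro tendsto_intros W)
      ultimately show ?thesis
        using greater by (simp add: l_def tendsto_cong)
    next
      case equal
      have "J n (W n) = bent G e v (W n)" for n
      proof -
        have s: "inner e (A + t n *\<^sub>R W n) = t n * inner e (W n)"
          using equal by (simp add: inner_add_right)
        show ?thesis
        proof (cases "inner e (W n)" "0::real" rule: linorder_cases)
          case less
          then show ?thesis
            using cases(2)[of n] t(1) by (simp add: s mult_pos_neg bent_def)
        next
          case greater
          then show ?thesis
            using cases(1)[of n] t(1) by (simp add: s bent_def)
        next
          case equal
          then show ?thesis
            using cases(3)[of n] by (auto simp: bent_def)
        qed
      qed
      moreover have "(\<lambda>n. bent G e v (W n)) \<longlonglongrightarrow> bent G e v V"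
        unfolding bent_def by (intro tendsto_intros W)
      ultimately show ?thesis
        using equal by (simp add: l_def)
    qed
  qed
  then show "\<exists>l. \<forall>W t J. W \<longlonglongrightarrow> V \<and> (\<forall>n. 0 < t n) \<and> t \<longlonglongrightarrow> 0 \<and>
      (\<forall>n. J n \<in> clarke_jacobian (bent G e v) (A + t n *\<^sub>R W n))
      \<longrightarrow> (\<lambda>n. blinfun_apply (J n) (W n)) \<longlonglongrightarrow> l"
    by blast
qed


section \<open>Regularity read off from the gradient\<close>

lemma GDERIV_imp_blinfun_derivative:
  assumes "GDERIV f x :> D"
  shows "(f has_derivative blinfun_apply (blinfun_inner_left D)) (at x)"
  using assms by (simp add: gderiv_def)

lemma C11_if_lipschitz_gradient:
  assumes grad: "\<And>x. GDERIV f x :> F x"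
    and lip: "\<And>x y. norm (F x - F y) \<le> L * norm (x - y)" and "L \<ge> 0"
  shows "C11 f"
  unfolding C11_def
proof (intro exI conjI allI)
  show "(f has_derivative blinfun_apply (blinfun_inner_left (F x))) (at x)" for x
    using grad by (rule GDERIV_imp_blinfun_derivative)
  have "norm (blinfun_inner_left (F x) - blinfun_inner_left (F y)) \<le> L * norm (x - y)" for x y
  proof -
    have "norm (blinfun_inner_left (F x) - blinfun_inner_left (F y)) \<le> norm (F x - F y)"
    proof (rule norm_blinfun_bound)
      fix z
      have "norm (inner z (F x - F y)) \<le> norm z * norm (F x - F y)"
        using Cauchy_Schwarz_ineq2 by simp
      then show "norm ((blinfun_inner_left (F x) - blinfun_inner_left (F y)) z)
          \<le> norm (F x - F y) * norm z"
        by (simp add: blinfun.diff_left inner_diff_right mult.commute)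
    qed simp
    also note lip
    finally show ?thesis .
  qed
  then show "locally_lipschitz (\<lambda>x. blinfun_inner_left (F x))"
    using \<open>L \<ge> 0\<close> by (rule lipschitz_imp_locally_lipschitz)
qed

lemma C2_if_linear_gradient:
  fixes G :: "'a::real_inner \<Rightarrow>\<^sub>L 'a"
  assumes "\<And>x. GDERIV f x :> G x"
  shows "C2_on UNIV f"
  unfolding C2_on_def
proof (intro exI conjI ballI)
  show "(f has_derivative blinfun_apply (blinfun_inner_left (G x))) (at x)" for x
    using assms by (rule GDERIV_imp_blinfun_derivative)
  let ?K = "Blinfun blinfun_inner_left o\<^sub>L G"
  have "blinfun_apply ?K = (\<lambda>x. blinfun_inner_left (G x))"
    by (auto simp: bounded_linear_Blinfun_apply bounded_linear_blinfun_inner_left)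
  then show "((\<lambda>x. blinfun_inner_left (G x)) has_derivative blinfun_apply ?K) (at x)" for x
    using bounded_linear_imp_has_derivative[OF blinfun.bounded_linear_right, of ?K] by simp
qed simp

text \<open>
  The Frechet derivative of \<open>f\<close> in the fixed direction \<open>e\<close> is again a bent linear map, now
  real-valued; its differentiability at \<open>0\<close> removes the bend.
\<close>

lemma C2_bent_gradient_imp:
  fixes e :: "'a::real_inner"
  assumes C2: "C2_on UNIV f" and grad: "\<And>x. GDERIV f x :> bent G e v x" and "e \<noteq> 0"
  shows "inner e v = 0"
proof -
  obtain f' f'' where f': "\<And>x. (f has_derivative blinfun_apply (f' x)) (at x)"
    and f'': "\<And>x. (f' has_derivative blinfun_apply (f'' x)) (at x)"
    using C2 by (auto simp: C2_on_def)
  have "f' x e = bent (blinfun_inner_right e o\<^sub>L G) e (inner e v) x" for x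
  proof -
    have "f' x e = inner e (bent G e v x)"
      using has_derivative_unique[OF f' grad[unfolded gderiv_def]] by (rule fun_cong)
    then show ?thesis
      by (simp add: bent_def inner_add_right)
  qed
  moreover have slope: "((\<lambda>x. f' x e) has_derivative (\<lambda>h. f'' 0 h e)) (at 0)"
    by (auto intro!: derivative_eq_intros f'')
  ultimately have "(bent (blinfun_inner_right e o\<^sub>L G) e (inner e v) has_derivative
      blinfun_apply (Blinfun (\<lambda>h. f'' 0 h e))) (at 0)"
    by (simp add: bounded_linear_Blinfun_apply[OF has_derivative_bounded_linear[OF slope]])
  from bent_derivative_on_hyperplane(2)[OF _ this, of e] show ?thesis
    using \<open>e \<noteq> 0\<close> by simp
qed

lemma C2_on_affine_image:
  assumes "C2_on S g"
  shows "C2_on S (\<lambda>d. p * g d + q :: real)"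
proof -
  obtain g' g'' where g': "\<And>x. x \<in> S \<Longrightarrow> (g has_derivative blinfun_apply (g' x)) (at x within S)"
    and g'': "\<And>x. x \<in> S \<Longrightarrow> (g' has_derivative blinfun_apply (g'' x)) (at x within S)"
    and cont: "continuous_on S g''"
    using assms unfolding C2_on_def by blast
  show ?thesis
    unfolding C2_on_def
  proof (intro exI conjI ballI)
    show "continuous_on S (\<lambda>x. p *\<^sub>R g'' x)"
      by (intro continuous_intros cont)
    fix x assume "x \<in> S"
    then show "((\<lambda>d. p * g d + q) has_derivative blinfun_apply (p *\<^sub>R g' x)) (at x within S)"
      by (auto intro!: derivative_eq_intros g' simp: blinfun.scaleR_left)
    show "((\<lambda>x. p *\<^sub>R g' x) has_derivative blinfun_apply (p *\<^sub>R g'' x)) (at x within S)"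
      using \<open>x \<in> S\<close> by (auto intro!: derivative_eq_intros g'' simp: blinfun.scaleR_left)
  qed
qed

section \<open>Trace and deviator\<close>

lemma tr_eq_inner: "tr A = inner sym_one A"
  by (simp add: tr_def inner_sym_eq_ddot ddot_def)

lemma tr_linear [simp]:
  "tr (A + B) = tr A + tr B" "tr (A - B) = tr A - tr B" "tr (s *\<^sub>R A) = s * tr A"
  by (simp_all add: tr_eq_inner inner_simps)

lemma tr_one [simp]: "tr (sym_one :: 'm::finite sym) = real CARD('m)"
  by (simp add: tr_def trace_I)

lemma inner_sym_one [simp]:
  "inner (sym_one :: 'm::finite sym) sym_one = real CARD('m)"
  by (simp flip: tr_eq_inner)

lemma norm_sym_one: "norm (sym_one :: 'm::finite sym) = sqrt (real CARD('m))"
  by (simp add: norm_eq_sqrt_inner)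

lemma sym_one_neq_0: "(sym_one :: 'm::finite sym) \<noteq> 0"
proof
  assume "(sym_one :: 'm sym) = 0"
  with inner_sym_one[where 'm = 'm] show False by simp
qed

lemma dev_linear [simp]:
  "dev (A + B) = dev A + dev B" "dev (A - B) = dev A - dev B" "dev (s *\<^sub>R A) = s *\<^sub>R dev A"
  by (simp_all add: dev_def algebra_simps add_divide_distrib diff_divide_distrib)

lemma bounded_linear_tr: "bounded_linear tr"
  unfolding tr_eq_inner by (rule bounded_linear_inner_right)

lemma bounded_linear_dev: "bounded_linear dev"
  by (simp add: linear_iff flip: linear_conv_bounded_linear)

lemma inner_dev_one: "inner (dev A) sym_one = 0"
  by (simp add: dev_def inner_diff_left flip: tr_eq_inner)
     (simp add: tr_eq_inner inner_commute)

lemma inner_dev_dev: "inner (dev A) (dev B) = inner (dev A) B"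
  by (subst (2) dev_def) (simp add: inner_diff_right inner_dev_one)

lemma norm_sym_decomposition:
  fixes A :: "'m::finite sym"
  shows "(norm A)\<^sup>2 = (tr A)\<^sup>2 / real CARD('m) + (norm (dev A))\<^sup>2"
proof -
  have "(norm (dev A))\<^sup>2 = inner (dev A) A"
    by (simp add: power2_norm_eq_inner inner_dev_dev)
  also have "\<dots> = (norm A)\<^sup>2 - (tr A)\<^sup>2 / real CARD('m)"
    by (simp add: dev_def inner_diff_left power2_norm_eq_inner power2_eq_square[of "tr A"]
        flip: tr_eq_inner)
  finally show ?thesis by simp
qed

lemma norm_dev_le: "norm (dev A) \<le> norm A"
proof -
  have "(norm (dev A))\<^sup>2 \<le> (norm A)\<^sup>2"
    using norm_sym_decomposition[of A] by simp
  then show ?thesis by (simp add: power2_le_iff_abs_le)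
qed

section \<open>Isotropic quadratic energies with an extra term in compression\<close>

text \<open>
  Damage weakens the material in tension only, so compression is at least as stiff.  Attaching the
  nonsmooth term to negative traces therefore gives it a nonnegative weight \<open>r\<close>.
\<close>

definition energy :: "real \<Rightarrow> real \<Rightarrow> real \<Rightarrow> 'm::finite sym \<Rightarrow> real" where
  "energy a c r A = a * (tr A)\<^sup>2 + c * (norm (dev A))\<^sup>2 + r * (min 0 (tr A))\<^sup>2"

text \<open>The gradient of the quadratic part of \<open>energy a c r\<close>.\<close>

lift_definition stiffness :: "real \<Rightarrow> real \<Rightarrow> 'm::finite sym \<Rightarrow>\<^sub>L 'm sym"
  is "\<lambda>a c A. (2 * a * tr A) *\<^sub>R sym_one + (2 * c) *\<^sub>R dev A"
  by (simp add: linear_iff algebra_simps flip: linear_conv_bounded_linear)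

lemma norm_stiffness_le:
  assumes "a \<ge> 0" "c \<ge> 0"
  shows "norm (stiffness a c :: 'm::finite sym \<Rightarrow>\<^sub>L 'm sym) \<le> 2 * a * real CARD('m) + 2 * c"
proof (rule norm_blinfun_bound)
  fix A :: "'m sym"
  have "\<bar>tr A\<bar> \<le> sqrt (real CARD('m)) * norm A"
    using Cauchy_Schwarz_ineq2[of sym_one A] by (simp add: tr_eq_inner norm_sym_one)
  then have "\<bar>tr A\<bar> * sqrt (real CARD('m)) \<le> sqrt (real CARD('m)) * norm A * sqrt (real CARD('m))"
    by (rule mult_right_mono) simp
  also have "\<dots> = real CARD('m) * norm A"
    by (simp add: algebra_simps)
  finally have tr: "2 * a * (\<bar>tr A\<bar> * sqrt (real CARD('m))) \<le> 2 * a * (real CARD('m) * norm A)"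
    using assms by (intro mult_left_mono) auto
  have "norm (stiffness a c A)
      \<le> norm ((2 * a * tr A) *\<^sub>R (sym_one :: 'm sym)) + norm ((2 * c) *\<^sub>R dev A)"
    by (simp only: stiffness.rep_eq norm_triangle_ineq)
  also have "\<dots> = 2 * a * (\<bar>tr A\<bar> * sqrt (real CARD('m))) + 2 * c * norm (dev A)"
    using assms by (simp add: norm_sym_one abs_mult)
  also have "\<dots> \<le> 2 * a * (real CARD('m) * norm A) + 2 * c * norm A"
    using assms by (intro add_mono tr mult_left_mono norm_dev_le) auto
  finally show "norm (stiffness a c A) \<le> (2 * a * real CARD('m) + 2 * c) * norm A"
    by (simp add: algebra_simps)
qed (use assms in auto)

abbreviation energy_gradient :: "real \<Rightarrow> real \<Rightarrow> real \<Rightarrow> 'm::finite sym \<Rightarrow> 'm sym" where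
  "energy_gradient a c r \<equiv> bent (stiffness a c) sym_one ((2 * r) *\<^sub>R sym_one)"

lemma DERIV_min_0_power2:
  "((\<lambda>s. (min 0 s)\<^sup>2) has_real_derivative 2 * min 0 s) (at (s::real))"
proof (cases s "0::real" rule: linorder_cases)
  case less
  have "((\<lambda>s. s\<^sup>2) has_real_derivative 2 * min 0 s) (at s)"
    using less by (auto intro!: derivative_eq_intros)
  then show ?thesis
    by (rule has_field_derivative_transform_within_open[of _ _ _ "{..<0}"]) (use less in auto)
next
  case equal
  have "(\<lambda>h::real. (min 0 h)\<^sup>2 / h) = min 0"
    by (auto simp: min_def power2_eq_square)
  moreover have "(min 0 \<longlongrightarrow> min 0 0) (at (0::real))"
    by (intro tendsto_intros)
  ultimately show ?thesis
    using equal by (simp add: DERIV_def)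
next
  case greater
  have "((\<lambda>s. 0) has_real_derivative 2 * min 0 s) (at s)"
    using greater by (auto intro!: derivative_eq_intros)
  then show ?thesis
    by (rule has_field_derivative_transform_within_open[of _ _ _ "{0<..}"]) (use greater in auto)
qed

lemma GDERIV_energy:
  fixes A :: "'m::finite sym"
  shows "GDERIV (energy a c r) A :> energy_gradient a c r A"
proof -
  note lin = bounded_linear_imp_has_derivative[OF bounded_linear_tr]
    bounded_linear_imp_has_derivative[OF bounded_linear_dev]
  have neg: "((\<lambda>A. (min 0 (tr A))\<^sup>2) has_derivative (\<lambda>h. 2 * min 0 (tr A) * tr h)) (at A)"
    by (rule has_derivative_compose[OF lin(1) DERIV_min_0_power2[unfolded has_field_derivative_def]])
  have quad: "((\<lambda>A. a * (tr A)\<^sup>2 + c * inner (dev A) (dev A)) has_derivative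
      (\<lambda>h. 2 * a * tr A * tr h + 2 * c * inner (dev A) (dev h))) (at A)"
    by (auto intro!: derivative_eq_intros lin simp: inner_commute algebra_simps)
  have "((\<lambda>A. a * (tr A)\<^sup>2 + c * inner (dev A) (dev A) + r * (min 0 (tr A))\<^sup>2)
      has_derivative
      (\<lambda>h. 2 * a * tr A * tr h + 2 * c * inner (dev A) (dev h) + r * (2 * min 0 (tr A) * tr h)))
      (at A)"
    by (rule has_derivative_add[OF quad has_derivative_mult_right[OF neg]])
  moreover have "(\<lambda>h. 2 * a * tr A * tr h + 2 * c * inner (dev A) (dev h)
      + r * (2 * min 0 (tr A) * tr h)) = (\<lambda>h. inner h (energy_gradient a c r A))"
  proof
    fix h :: "'m sym"
    have "inner h sym_one = tr h" "inner h (dev A) = inner (dev A) (dev h)"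
      by (simp_all add: tr_eq_inner inner_dev_dev inner_commute)
    then show "2 * a * tr A * tr h + 2 * c * inner (dev A) (dev h)
        + r * (2 * min 0 (tr A) * tr h) = inner h (energy_gradient a c r A)"
      by (simp add: bent_def stiffness.rep_eq inner_add_right flip: tr_eq_inner)
  qed
  ultimately show ?thesis
    by (simp add: gderiv_def energy_def[abs_def] power2_norm_eq_inner)
qed

lemma square_convex_comb:
  "(t * x + (1 - t) * y)\<^sup>2 = t * x\<^sup>2 + (1 - t) * y\<^sup>2 - t * (1 - t) * (x - y)\<^sup>2" for x y :: real
  by (simp add: power2_eq_square algebra_simps)

lemma norm_square_convex_comb:
  fixes x y :: "'a::real_inner"
  shows "(norm (t *\<^sub>R x + (1 - t) *\<^sub>R y))\<^sup>2
     = t * (norm x)\<^sup>2 + (1 - t) * (norm y)\<^sup>2 - t * (1 - t) * (norm (x - y))\<^sup>2"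
  by (simp add: power2_norm_eq_inner inner_simps inner_commute algebra_simps)

lemma min_0_square_convex:
  fixes x y t :: real
  assumes "t \<in> {0..1}"
  shows "(min 0 (t * x + (1 - t) * y))\<^sup>2 \<le> t * (min 0 x)\<^sup>2 + (1 - t) * (min 0 y)\<^sup>2"
proof -
  let ?z = "t * min 0 x + (1 - t) * min 0 y"
  have le: "t * min 0 x \<le> 0" "(1 - t) * min 0 y \<le> 0" "t * min 0 x \<le> t * x"
      "(1 - t) * min 0 y \<le> (1 - t) * y"
    using assms by (auto simp: mult_le_0_iff intro!: mult_left_mono)
  then have "\<bar>min 0 (t * x + (1 - t) * y)\<bar> \<le> \<bar>?z\<bar>"
    by linarith
  then have "(min 0 (t * x + (1 - t) * y))\<^sup>2 \<le> ?z\<^sup>2"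
    by (rule abs_le_square_iff[THEN iffD1])
  also have "\<dots> \<le> t * (min 0 x)\<^sup>2 + (1 - t) * (min 0 y)\<^sup>2"
    using assms by (simp add: square_convex_comb)
  finally show ?thesis .
qed

lemma quadratic_part_coercive:
  fixes A :: "'m::finite sym"
  shows "min (a * real CARD('m)) c * (norm A)\<^sup>2 \<le> a * (tr A)\<^sup>2 + c * (norm (dev A))\<^sup>2"
proof -
  let ?\<gamma> = "min (a * real CARD('m)) c"
  have "?\<gamma> * (norm A)\<^sup>2 = ?\<gamma> * ((tr A)\<^sup>2 / real CARD('m)) + ?\<gamma> * (norm (dev A))\<^sup>2"
    by (simp add: norm_sym_decomposition[of A] distrib_left)
  also have "\<dots> \<le> a * real CARD('m) * ((tr A)\<^sup>2 / real CARD('m)) + c * (norm (dev A))\<^sup>2"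
    by (intro add_mono mult_right_mono) auto
  finally show ?thesis by simp
qed

text \<open>
  For the quadratic part the convexity defect is exactly the quadratic form of \<open>A - B\<close>; the term in
  compression is convex.
\<close>

lemma energy_strongly_convex:
  fixes A B :: "'m::finite sym"
  assumes "r \<ge> 0" and t: "t \<in> {0..1}"
  shows "energy a c r (t *\<^sub>R A + (1 - t) *\<^sub>R B) \<le> t * energy a c r A + (1 - t) * energy a c r B
    - t * (1 - t) * (min (a * real CARD('m)) c * (norm (A - B))\<^sup>2)"
proof -
  have "r * (min 0 (tr (t *\<^sub>R A + (1 - t) *\<^sub>R B)))\<^sup>2
      \<le> r * (t * (min 0 (tr A))\<^sup>2 + (1 - t) * (min 0 (tr B))\<^sup>2)"
    unfolding tr_linear by (intro mult_left_mono min_0_square_convex assms)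
  moreover have "(tr (t *\<^sub>R A + (1 - t) *\<^sub>R B))\<^sup>2
      = t * (tr A)\<^sup>2 + (1 - t) * (tr B)\<^sup>2 - t * (1 - t) * (tr (A - B))\<^sup>2"
    unfolding tr_linear by (rule square_convex_comb)
  moreover have "(norm (dev (t *\<^sub>R A + (1 - t) *\<^sub>R B)))\<^sup>2
      = t * (norm (dev A))\<^sup>2 + (1 - t) * (norm (dev B))\<^sup>2 - t * (1 - t) * (norm (dev (A - B)))\<^sup>2"
    unfolding dev_linear by (rule norm_square_convex_comb)
  ultimately have "energy a c r (t *\<^sub>R A + (1 - t) *\<^sub>R B) \<le> t * energy a c r A + (1 - t) * energy a c r B
    - t * (1 - t) * (a * (tr (A - B))\<^sup>2 + c * (norm (dev (A - B)))\<^sup>2)"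
    unfolding energy_def by (simp only:) (simp add: algebra_simps del: tr_linear dev_linear)
  moreover have "t * (1 - t) * (min (a * real CARD('m)) c * (norm (A - B))\<^sup>2)
      \<le> t * (1 - t) * (a * (tr (A - B))\<^sup>2 + c * (norm (dev (A - B)))\<^sup>2)"
    using t by (intro mult_left_mono quadratic_part_coercive) auto
  ultimately show ?thesis by linarith
qed

lemma energy_coercive:
  fixes A :: "'m::finite sym"
  assumes "r \<ge> 0"
  shows "min (a * real CARD('m)) c * (norm A)\<^sup>2 \<le> energy a c r A"
  using quadratic_part_coercive[of a c A] mult_nonneg_nonneg[OF assms zero_le_power2[of "min 0 (tr A)"]]
  unfolding energy_def by linarith

lemma C2_energy_iff:
  "C2_on UNIV (energy a c r :: 'm::finite sym \<Rightarrow> real) \<longleftrightarrow> r = 0"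
proof
  assume "C2_on UNIV (energy a c r :: 'm sym \<Rightarrow> real)"
  from C2_bent_gradient_imp[OF this GDERIV_energy sym_one_neq_0] show "r = 0"
    by simp
next
  assume "r = 0"
  then have *: "bent (stiffness a c) sym_one ((2 * r) *\<^sub>R sym_one) A = stiffness a c A" for A :: "'m sym"
    by (simp add: bent_def)
  from GDERIV_energy[of a c r] show "C2_on UNIV (energy a c r :: 'm sym \<Rightarrow> real)"
    by (intro C2_if_linear_gradient[of _ "stiffness a c"]) (simp flip: *)
qed

section \<open>The damaged energy density\<close>

lemma psi_eq_energy:
  fixes A :: "'m::finite sym" and mu lam :: real
  defines "\<kappa> \<equiv> mu / real CARD('m) + lam / 2"
  shows "psi mu lam g k A d = energy (\<kappa> * (g d + k)) ((1 + k) * mu) (\<kappa> * (1 - g d)) A"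
proof -
  have "(max 0 (tr A))\<^sup>2 = (tr A)\<^sup>2 - (min 0 (tr A))\<^sup>2"
    by (auto simp: max_def min_def)
  then show ?thesis
    by (simp add: psi_def psi0_plus_def psi0_minus_def energy_def power2_norm_eq_inner
        flip: inner_sym_eq_ddot \<kappa>_def) (simp add: algebra_simps)
qed

text \<open>
  On the line of spherical matrices \<open>s I\<close> the energy \<open>psi0\<close> is \<open>s\<^sup>2 m\<^sup>2 \<kappa>\<close>, and the midpoint \<open>0\<close> of
  \<open>I\<close> and \<open>- I\<close> forces \<open>\<kappa>\<close> to be positive.
\<close>

lemma bulk_modulus_pos:
  assumes "strongly_convex (psi0 mu lam :: 'm::finite sym \<Rightarrow> real)"
  shows "mu / real CARD('m) + lam / 2 > 0"
proof -
  let ?m = "real CARD('m)" and ?I = "sym_one :: 'm sym"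
  have m: "?m > 0" by simp
  have psi0: "psi0 mu lam (s *\<^sub>R ?I) = s\<^sup>2 * ?m\<^sup>2 * (mu / ?m + lam / 2)" for s
  proof -
    have "ddot (s *\<^sub>R ?I) (s *\<^sub>R ?I) = s\<^sup>2 * ?m"
      by (simp add: power2_eq_square flip: inner_sym_eq_ddot)
    then have "psi0 mu lam (s *\<^sub>R ?I) = lam / 2 * (s * ?m)\<^sup>2 + mu * (s\<^sup>2 * ?m)"
      unfolding psi0_def ddot_def transpose_mat_of_sym by simp
    then show ?thesis
      by (simp add: power2_eq_square field_simps)
  qed
  obtain \<eta> where "\<eta> > 0" and \<eta>: "\<And>A B :: 'm sym. \<And>t. t \<in> {0..1} \<Longrightarrow>
      psi0 mu lam (t *\<^sub>R A + (1 - t) *\<^sub>R B)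
        \<le> t * psi0 mu lam A + (1 - t) * psi0 mu lam B - 1 / 2 * \<eta> * t * (1 - t) * (norm (A - B))\<^sup>2"
    using assms unfolding strongly_convex_def by blast
  have "psi0 mu lam (0 *\<^sub>R ?I) \<le> psi0 mu lam (1 *\<^sub>R ?I) / 2 + psi0 mu lam ((-1) *\<^sub>R ?I) / 2
      - \<eta> / 8 * (norm (2 *\<^sub>R ?I))\<^sup>2"
    using \<eta>[of "1/2" ?I "- ?I"] by (simp add: scaleR_2)
  then have "\<eta> / 2 * ?m \<le> ?m\<^sup>2 * (mu / ?m + lam / 2)"
    unfolding psi0 by (simp add: norm_sym_one power_mult_distrib)
  then have "0 < ?m\<^sup>2 * (mu / ?m + lam / 2)"
    using \<open>\<eta> > 0\<close> m by (smt (verit) half_gt_zero mult_pos_pos)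
  then show ?thesis
    by (simp add: zero_less_mult_iff)
qed

theorem lemma2p8:
  fixes mu lam k :: real
    and g :: "real \<Rightarrow> real"
  assumes mu: "mu > 0"
    and lam: "lam > - (2 / 3) * mu"
    and psi0_convex: "strongly_convex (psi0 mu lam :: 'm::finite sym \<Rightarrow> real)"
    and g_range: "g ` {0..1} \<subseteq> {0..1}"
    and g_convex: "convex_on {0..1} g"
    and g_C2: "C2_on {0..1} g"
    and g_mono: "antimono_on {0..1} g"
    and g_0: "g 0 = 1"
    and g_1: "g 1 = 0"
    and k: "k > 0"
  shows
    "(\<forall>\<epsilon> :: 'm sym. C2_on {0..1} (\<lambda>d. psi mu lam g k \<epsilon> d))
     \<and> (\<forall>d\<in>{0..1}. C11 (\<lambda>\<epsilon> :: 'm sym. psi mu lam g k \<epsilon> d))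
     \<and> (\<forall>d\<in>{0..1}. semismooth (gradient (\<lambda>\<epsilon> :: 'm sym. psi mu lam g k \<epsilon> d)))
     \<and> (\<exists>L\<ge>0. \<forall>d\<in>{0..1}. \<forall>A B :: 'm sym.
          norm (gradient (\<lambda>\<epsilon>. psi mu lam g k \<epsilon> d) A - gradient (\<lambda>\<epsilon>. psi mu lam g k \<epsilon> d) B)
            \<le> L * norm (A - B))
     \<and> (\<exists>\<eta>>0. \<forall>d\<in>{0..1}. \<forall>A B :: 'm sym. \<forall>t\<in>{0..1}.
          psi mu lam g k (t *\<^sub>R A + (1 - t) *\<^sub>R B) d
            \<le> t * psi mu lam g k A d + (1 - t) * psi mu lam g k B d
               - 1 / 2 * \<eta> * t * (1 - t) * (norm (A - B))\<^sup>2)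
     \<and> (\<exists>C>0. \<forall>d\<in>{0..1}. \<forall>\<epsilon> :: 'm sym. psi mu lam g k \<epsilon> d \<ge> C * (norm \<epsilon>)\<^sup>2)
     \<and> (\<forall>d\<in>{0..1}. C2_on UNIV (\<lambda>\<epsilon> :: 'm sym. psi mu lam g k \<epsilon> d) \<longleftrightarrow> g d = 1)"
proof -
  define \<kappa> where "\<kappa> = mu / real CARD('m) + lam / 2"
  define a where "a d = \<kappa> * (g d + k)" for d
  define c where "c = (1 + k) * mu"
  define r where "r d = \<kappa> * (1 - g d)" for d
  let ?\<gamma> = "min (\<kappa> * k * real CARD('m)) c"
  have \<kappa>: "\<kappa> > 0"
    using bulk_modulus_pos[OF psi0_convex] by (simp add: \<kappa>_def)
  have c: "c > 0"
    using mu k by (simp add: c_def)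
  have g: "0 \<le> g d" "g d \<le> 1" if "d \<in> {0..1}" for d
    using g_range that by (auto simp: image_subset_iff)
  have r: "0 \<le> r d" "r d \<le> \<kappa>" if "d \<in> {0..1}" for d
    using g[OF that] \<kappa> by (auto simp: r_def mult_le_cancel_left1)
  have a: "\<kappa> * k \<le> a d" "a d \<le> \<kappa> * (1 + k)" if "d \<in> {0..1}" for d
    using g[OF that] \<kappa> by (auto simp: a_def)
  have \<kappa>k: "\<kappa> * k > 0"
    using \<kappa> k by simp
  have \<gamma>: "?\<gamma> > 0"
    using \<kappa> c k by simp
  have psi: "psi mu lam g k A d = energy (a d) c (r d) A" for A :: "'m sym" and d
    unfolding a_def c_def r_def \<kappa>_def by (rule psi_eq_energy)
  have \<gamma>_le: "?\<gamma> * s \<le> min (a d * real CARD('m)) c * s" if "d \<in> {0..1}" "s \<ge> 0" for d s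
    using a(1)[OF that(1)] that(2) by (intro mult_right_mono min.mono) auto
  have grad: "gradient (energy (a d) c (r d)) = energy_gradient (a d) c (r d)" for d
    by (rule ext, rule gradient_eqI, rule GDERIV_energy)

  \<comment> \<open>The Lipschitz constant of a bent map, with \<open>a d\<close> and \<open>r d\<close> replaced by bounds free of \<open>d\<close>.\<close>
  define L where "L = 2 * (\<kappa> * (1 + k)) * real CARD('m) + 2 * c + 2 * \<kappa> * real CARD('m)"
  have "L \<ge> 0"
    using \<kappa> k c by (simp add: L_def)
  have lip: "norm (energy_gradient (a d) c (r d) A - energy_gradient (a d) c (r d) B)
      \<le> L * norm (A - B)" if d: "d \<in> {0..1}" for d and A B :: "'m sym"
  proof -
    have "norm (stiffness (a d) c :: 'm sym \<Rightarrow>\<^sub>L 'm sym) \<le> 2 * a d * real CARD('m) + 2 * c"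
      using a(1)[OF d] \<kappa>k c by (intro norm_stiffness_le) auto
    also have "\<dots> \<le> 2 * (\<kappa> * (1 + k)) * real CARD('m) + 2 * c"
      using a(2)[OF d] by simp
    finally have "norm (stiffness (a d) c :: 'm sym \<Rightarrow>\<^sub>L 'm sym)
        \<le> 2 * (\<kappa> * (1 + k)) * real CARD('m) + 2 * c" .
    moreover have "norm (sym_one :: 'm sym) * norm ((2 * r d) *\<^sub>R sym_one :: 'm sym)
        = 2 * r d * real CARD('m)"
      using r[OF d] by (simp add: norm_sym_one)
    moreover have "2 * r d * real CARD('m) \<le> 2 * \<kappa> * real CARD('m)"
      using r[OF d] by simp
    ultimately have "norm (stiffness (a d) c :: 'm sym \<Rightarrow>\<^sub>L 'm sym)
        + norm (sym_one :: 'm sym) * norm ((2 * r d) *\<^sub>R sym_one :: 'm sym) \<le> L"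
      unfolding L_def by linarith
    then show ?thesis
      by (intro order_trans[OF bent_lipschitz] mult_right_mono) auto
  qed

  have P1a: "C2_on {0..1} (\<lambda>d. psi mu lam g k A d)" for A :: "'m sym"
  proof -
    have "(\<lambda>d. psi mu lam g k A d)
        = (\<lambda>d. psi0_plus mu lam A * g d + (k * psi0_plus mu lam A + (1 + k) * psi0_minus mu lam A))"
      by (simp add: psi_def fun_eq_iff algebra_simps)
    then show ?thesis
      using C2_on_affine_image[OF g_C2] by simp
  qed
  have P1b: "C11 (\<lambda>A :: 'm sym. psi mu lam g k A d)" if "d \<in> {0..1}" for d
    unfolding psi using GDERIV_energy lip[OF that] \<open>L \<ge> 0\<close> by (rule C11_if_lipschitz_gradient)
  \<comment> \<open>The convexity estimate has no factor \<open>1/2\<close>, hence \<open>\<eta> = 2 \<gamma>\<close>.\<close>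
  have P4: "psi mu lam g k (t *\<^sub>R A + (1 - t) *\<^sub>R B) d
      \<le> t * psi mu lam g k A d + (1 - t) * psi mu lam g k B d
        - 1 / 2 * (2 * ?\<gamma>) * t * (1 - t) * (norm (A - B))\<^sup>2"
    if d: "d \<in> {0..1}" and t: "t \<in> {0..1}" for d t and A B :: "'m sym"
  proof -
    have "t * (1 - t) * (?\<gamma> * (norm (A - B))\<^sup>2)
        \<le> t * (1 - t) * (min (a d * real CARD('m)) c * (norm (A - B))\<^sup>2)"
      using t by (intro mult_left_mono \<gamma>_le d) auto
    with energy_strongly_convex[OF r(1)[OF d] t, of "a d" c A B] show ?thesis
      unfolding psi by (simp add: algebra_simps)
  qed
  have P5: "psi mu lam g k A d \<ge> ?\<gamma> * (norm A)\<^sup>2" if d: "d \<in> {0..1}" for d and A :: "'m sym"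
    using order_trans[OF \<gamma>_le energy_coercive] d r(1)[OF d] by (simp add: psi)
  have C2: "C2_on UNIV (\<lambda>A :: 'm sym. psi mu lam g k A d) \<longleftrightarrow> g d = 1" for d
    unfolding psi C2_energy_iff using \<kappa> by (simp add: r_def)
  show ?thesis
  proof (intro conjI)
    show "\<exists>L\<ge>0. \<forall>d\<in>{0..1}. \<forall>A B :: 'm sym.
        norm (gradient (\<lambda>\<epsilon>. psi mu lam g k \<epsilon> d) A - gradient (\<lambda>\<epsilon>. psi mu lam g k \<epsilon> d) B)
          \<le> L * norm (A - B)"
      unfolding psi grad using \<open>L \<ge> 0\<close> lip by blast
    show "\<forall>d\<in>{0..1}. semismooth (gradient (\<lambda>\<epsilon> :: 'm sym. psi mu lam g k \<epsilon> d))"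
      unfolding psi grad by (blast intro: semismooth_bent)
    show "\<exists>\<eta>>0. \<forall>d\<in>{0..1}. \<forall>A B :: 'm sym. \<forall>t\<in>{0..1}.
          psi mu lam g k (t *\<^sub>R A + (1 - t) *\<^sub>R B) d
            \<le> t * psi mu lam g k A d + (1 - t) * psi mu lam g k B d
               - 1 / 2 * \<eta> * t * (1 - t) * (norm (A - B))\<^sup>2"
      using \<gamma> P4 by (intro exI[of _ "2 * ?\<gamma>"]) auto
  qed (use P1a P1b P5 C2 \<gamma> in blast)+
qed

end
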